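(* Let $m\ge0$ be an integer, let $a,b,c\in\mathbb{C}$ with $c\notin\{0,-1,-2,\ldots\}$ and $a,b\notin\{-1,-2,\ldots,-m\}$, and put $\delta=1+a+b-c$. Then $$\sum_{n=0}^{m}\frac{(a)_n(b)_n}{(c)_n n!}=\frac{(a+1)_m(b+1)_m}{(c)_m\,m!}\sum_{j=0}^{m}(-1)^j\binom{m}{j}\frac{(\delta)_j\,j!}{(a+1)_j(b+1)_j}.$$
   Context: $(u)_0=1$ and $(u)_n=u(u+1)\cdots(u+n-1)$ for $n\ge1$. *)

theory Defs
  imports Complex_Main "HOL-Library.Nonpos_Ints"
begin

end

theory Submission
  imports Defs
begin

text \<open>
  After multiplication by \<open>(c)\<^sub>m m!\<close> the right-hand side loses its denominators and becomes
  \<open>T\<^sub>m = \<Sum>\<^sub>j (-1)\<^sup>j (m!/(m-j)!) (\<delta>)\<^sub>j (a+1+j)\<^bsub>m-j\<^esub> (b+1+j)\<^bsub>m-j\<^esub>\<close>. Passing from \<open>m\<close> to \<open>m+1\<close>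
  multiplies the factor \<open>(c)\<^sub>m m!\<close> by \<open>(c+m)(m+1)\<close> and adds one term to the left-hand
  side, so by induction on \<open>m\<close> the theorem amounts to the recurrence
  \<open>T\<^bsub>m+1\<^esub> = (c+m)(m+1) T\<^sub>m + (a)\<^bsub>m+1\<^esub> (b)\<^bsub>m+1\<^esub>\<close>.

  The recurrence is proved by creative telescoping. If \<open>t m j\<close> denotes the summand of \<open>T\<^sub>m\<close>, the
  companion \<open>G j = (-1)\<^sup>j ((m+1)!/(m+1-j)!) (\<delta>)\<^sub>j (a+j)\<^bsub>m+1-j\<^esub> (b+j)\<^bsub>m+1-j\<^esub>\<close> satisfies
  \<open>t (m+1) j - (c+m)(m+1) t m j = G j - G (j+1)\<close> for \<open>j \<le> m\<close>. It starts at
  \<open>G 0 = (a)\<^bsub>m+1\<^esub> (b)\<^bsub>m+1\<^esub>\<close>, the new term on the left, and ends at \<open>G (m+1) = t (m+1) (m+1)\<close>, the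
  one summand of \<open>T\<^bsub>m+1\<^esub>\<close> that has no counterpart in \<open>T\<^sub>m\<close>.
\<close>

text \<open>
  The summand and its telescoping companion have the same shape: the former is the case
  \<open>x = a + 1\<close>, \<open>y = b + 1\<close>, the latter the case \<open>x = a\<close>, \<open>y = b\<close> with \<open>m + 1\<close> for \<open>m\<close>. The
  quotient \<open>m!/(m-j)!\<close> stands for \<open>j!\<close> times the binomial coefficient.
\<close>

definition cleared_summand :: "'a::field_char_0 \<Rightarrow> 'a \<Rightarrow> 'a \<Rightarrow> nat \<Rightarrow> nat \<Rightarrow> 'a" where
  "cleared_summand x y \<delta> m j =
    (-1) ^ j * (fact m / fact (m - j)) * pochhammer \<delta> j *
      (pochhammer (x + of_nat j) (m - j) * pochhammer (y + of_nat j) (m - j))"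

text \<open>
  All four terms are polynomial multiples of \<open>t m j\<close> up to the factor \<open>1/(d+1)\<close>, where
  \<open>d = m - j\<close>. Comparing the multipliers leaves
  \<open>(a+1+m)(b+1+m) - (a+j)(b+j) = (d+1)(1+a+b+m+j)\<close>, and the last factor is
  \<open>(c+m) + (\<delta>+j)\<close> by the choice of \<open>\<delta>\<close>.
\<close>

lemma cleared_summand_telescopes:
  fixes a b c \<delta> :: "'a::field_char_0"
  assumes "j \<le> m" and \<delta>: "\<delta> = 1 + a + b - c"
  shows "cleared_summand (a + 1) (b + 1) \<delta> (Suc m) j
      - (c + of_nat m) * of_nat (Suc m) * cleared_summand (a + 1) (b + 1) \<delta> m j
    = cleared_summand a b \<delta> (Suc m) j - cleared_summand a b \<delta> (Suc m) (Suc j)"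
proof -
  obtain d where m: "m = j + d"
    using \<open>j \<le> m\<close> le_Suc_ex by blast
  define A where "A = pochhammer (a + 1 + of_nat j) d"
  define B where "B = pochhammer (b + 1 + of_nat j) d"
  define s where "s = (-1) ^ j * pochhammer \<delta> j * (A * B)"
  define q where "q = (fact m / fact d :: 'a)"
  define D where "D = (of_nat (Suc d) :: 'a)"
  define M where "M = (of_nat (Suc m) :: 'a)"
  have D0: "D \<noteq> 0" unfolding D_def using of_nat_neq_0 by blast
  have M: "M = of_nat j + D" by (simp add: M_def D_def m)
  have shift: "x + of_nat (Suc j) = x + 1 + of_nat j" for x :: 'a
    by simp
  have fact_ratio: "fact (Suc m) / fact (Suc d) = q * M / D"
    by (simp add: q_def M_def D_def mult.commute)
  have fact_ratio': "fact (Suc m) / fact d = q * M"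
    by (simp add: q_def M_def)
  have raise: "pochhammer (x + 1 + of_nat j) (Suc d) = pochhammer (x + 1 + of_nat j) d * (x + M)"
    for x :: 'a by (simp add: pochhammer_Suc M_def m algebra_simps)
  have lower: "pochhammer (x + of_nat j) (Suc d) = (x + of_nat j) * pochhammer (x + 1 + of_nat j) d"
    for x :: 'a by (simp add: pochhammer_rec algebra_simps)
  have diffs: "Suc m - j = Suc d" "m - j = d" "Suc m - Suc j = d"
    by (simp_all add: m)
  have t: "cleared_summand (a + 1) (b + 1) \<delta> m j = s * q"
    unfolding cleared_summand_def diffs s_def A_def B_def q_def by simp
  have t_Suc: "cleared_summand (a + 1) (b + 1) \<delta> (Suc m) j = s * (q * M / D) * ((a + M) * (b + M))"
    unfolding cleared_summand_def diffs raise fact_ratio s_def A_def B_def by (simp only: ac_simps)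
  have G: "cleared_summand a b \<delta> (Suc m) j
      = s * (q * M / D) * ((a + of_nat j) * (b + of_nat j))"
    unfolding cleared_summand_def diffs lower fact_ratio s_def A_def B_def by (simp only: ac_simps)
  have G_Suc: "cleared_summand a b \<delta> (Suc m) (Suc j) = - (s * (q * M) * (\<delta> + of_nat j))"
    unfolding cleared_summand_def diffs shift fact_ratio' s_def A_def B_def
    by (simp add: pochhammer_Suc ac_simps)
  have "(a + M) * (b + M) - (a + of_nat j) * (b + of_nat j)
      = D * ((c + of_nat m) + (\<delta> + of_nat j))"
  proof -
    have m_eq: "of_nat m = of_nat j + D - 1" by (simp add: D_def m)
    show ?thesis unfolding \<delta> M m_eq by (simp add: algebra_simps)
  qed
  then have "s * (q * M / D) * ((a + M) * (b + M) - (a + of_nat j) * (b + of_nat j))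
      = s * (q * M) * ((c + of_nat m) + (\<delta> + of_nat j))"
    using D0 by simp
  then show ?thesis
    unfolding t t_Suc G G_Suc M_def[symmetric] by (simp add: algebra_simps add_divide_distrib)
qed

lemma sum_cleared_summand_Suc:
  fixes a b c \<delta> :: "'a::field_char_0"
  assumes \<delta>: "\<delta> = 1 + a + b - c"
  shows "(\<Sum>j\<le>Suc m. cleared_summand (a + 1) (b + 1) \<delta> (Suc m) j)
    = (c + of_nat m) * of_nat (Suc m) * (\<Sum>j\<le>m. cleared_summand (a + 1) (b + 1) \<delta> m j)
      + pochhammer a (Suc m) * pochhammer b (Suc m)"
proof -
  let ?t = "cleared_summand (a + 1) (b + 1) \<delta>" and ?G = "cleared_summand a b \<delta> (Suc m)"
  have "(\<Sum>j\<le>m. ?t (Suc m) j) - (c + of_nat m) * of_nat (Suc m) * (\<Sum>j\<le>m. ?t m j)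
      = (\<Sum>j\<le>m. ?t (Suc m) j - (c + of_nat m) * of_nat (Suc m) * ?t m j)"
    by (simp only: sum_subtractf sum_distrib_left)
  also have "\<dots> = (\<Sum>j\<le>m. ?G j - ?G (Suc j))"
    using cleared_summand_telescopes[OF _ \<delta>] by (intro sum.cong) auto
  also have "\<dots> = ?G 0 - ?G (Suc m)"
    by (rule sum_telescope)
  also have "?G 0 = pochhammer a (Suc m) * pochhammer b (Suc m)"
    by (simp add: cleared_summand_def del: fact_Suc)
  also have "?G (Suc m) = ?t (Suc m) (Suc m)"
    by (simp add: cleared_summand_def)
  finally show ?thesis
    by (simp add: algebra_simps del: of_nat_Suc)
qed

lemma sum_cleared_summand_eq:
  fixes a b c \<delta> :: "'a::field_char_0"
  assumes c: "c \<notin> \<int>\<^sub>\<le>\<^sub>0" and \<delta>: "\<delta> = 1 + a + b - c"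
  shows "(\<Sum>j\<le>m. cleared_summand (a + 1) (b + 1) \<delta> m j)
    = pochhammer c m * fact m *
        (\<Sum>n\<le>m. pochhammer a n * pochhammer b n / (pochhammer c n * fact n))"
proof (induction m)
  case 0
  show ?case by (simp add: cleared_summand_def)
next
  case (Suc m)
  have c0: "pochhammer c (Suc m) * fact (Suc m) \<noteq> 0"
    using c by (auto simp: pochhammer_eq_0_iff simp del: fact_Suc)
  let ?S = "\<lambda>m. \<Sum>n\<le>m. pochhammer a n * pochhammer b n / (pochhammer c n * fact n)"
  have "(c + of_nat m) * of_nat (Suc m) * (pochhammer c m * fact m * ?S m)
      = pochhammer c (Suc m) * fact (Suc m) * ?S m"
    by (simp only: pochhammer_Suc fact_Suc ac_simps)
  then show ?case
    unfolding sum_cleared_summand_Suc[OF \<delta>] Suc.IH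
    using c0 by (simp add: distrib_left del: fact_Suc of_nat_Suc)
qed

text \<open>
  The splitting \<open>(x)\<^sub>m = (x)\<^sub>j (x+j)\<^bsub>m-j\<^esub>\<close> cancels the denominators; this is where the
  exclusion of the values \<open>-1, \<dots>, -m\<close> for \<open>x - 1\<close> and \<open>y - 1\<close> enters.
\<close>

lemma cleared_summand_eq_quotient:
  fixes x y \<delta> :: "'a::field_char_0"
  assumes "j \<le> m" and x: "pochhammer x m \<noteq> 0" and y: "pochhammer y m \<noteq> 0"
  shows "cleared_summand x y \<delta> m j = pochhammer x m * pochhammer y m *
    ((-1) ^ j * of_nat (m choose j) *
      (pochhammer \<delta> j * fact j / (pochhammer x j * pochhammer y j)))"
proof -
  note split = pochhammer_product[OF \<open>j \<le> m\<close>]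
  have "pochhammer x j \<noteq> 0" "pochhammer y j \<noteq> 0"
    using x y unfolding split[of x] split[of y] by auto
  then show ?thesis
    unfolding cleared_summand_def split[of x] split[of y] binomial_fact[OF \<open>j \<le> m\<close>]
    by (simp add: field_simps)
qed

theorem theorem6p1:
  fixes m :: nat and a b c \<delta> :: complex
  assumes "c \<notin> \<int>\<^sub>\<le>\<^sub>0"
    and "a \<notin> {- of_nat k |k. 1 \<le> k \<and> k \<le> m}"
    and "b \<notin> {- of_nat k |k. 1 \<le> k \<and> k \<le> m}"
    and "\<delta> = 1 + a + b - c"
  shows "(\<Sum>n=0..m. pochhammer a n * pochhammer b n / (pochhammer c n * fact n)) =
    pochhammer (a + 1) m * pochhammer (b + 1) m / (pochhammer c m * fact m) *
      (\<Sum>j=0..m. (-1) ^ j * of_nat (m choose j) *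
        (pochhammer \<delta> j * fact j / (pochhammer (a + 1) j * pochhammer (b + 1) j)))"
    (is "?S = ?P / ?C * ?R")
proof -
  have pochhammer_nonzero: "pochhammer (z + 1) m \<noteq> 0"
    if z: "z \<notin> {- of_nat k |k. 1 \<le> k \<and> k \<le> m}" for z :: complex
  proof
    assume "pochhammer (z + 1) m = 0"
    then obtain k where "k < m" "z + 1 = - of_nat k"
      by (auto simp: pochhammer_eq_0_iff)
    then have "z = - of_nat (Suc k)" "1 \<le> Suc k" "Suc k \<le> m"
      by (auto simp: algebra_simps eq_neg_iff_add_eq_0)
    with z show False by blast
  qed
  have "?C \<noteq> 0"
    using assms(1) by (auto simp: pochhammer_eq_0_iff)
  have "?P * ?R = (\<Sum>j\<le>m. cleared_summand (a + 1) (b + 1) \<delta> m j)"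
    unfolding sum_distrib_left atMost_atLeast0
    using cleared_summand_eq_quotient[OF _ pochhammer_nonzero[OF assms(2)] pochhammer_nonzero[OF assms(3)]]
    by (intro sum.cong) simp_all
  also have "\<dots> = ?C * ?S"
    using sum_cleared_summand_eq[OF assms(1,4)] by (simp add: atMost_atLeast0)
  finally show ?thesis
    using \<open>?C \<noteq> 0\<close> by (simp add: field_simps)
qed

end
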